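(* Let $q$ be a prime power, $s\ge2$, the bases $\mathfrak{B}_{m,i}$ be as in the context, and let $\boldsymbol{\alpha}=(\alpha_1,\ldots,\alpha_s)\in Y^s$ with $\alpha_i=\sum_{j\ge0}a_{i,j}x^j$. For $i=1,\ldots,s$ define $B_i\in\mathbb{F}_q^{\mathbb{N}\times\mathbb{N}}$ by letting, for each $j\in\mathbb{N}$, the first $j$ entries of the $j$-th column be the coefficients (of $1,x,\ldots,x^{j-1}$) of $\mathfrak{b}_{j,i,j}$ modulo $x^j$ and all other entries of that column be $0$; and let $\Psi(\alpha_i)\in\mathbb{F}_q^{\mathbb{N}\times\mathbb{N}}$ be the infinite lower triangular Toeplitz matrix whose entry in row $r$ and column $c$ (indices starting at $1$) is $a_{i,r-c}$ if $r\ge c$ and $0$ otherwise. Then the matrices $C_i=(\Psi(\alpha_i)B_i)^\top$, $i=1,\ldots,s$, are generating matrices of a hyperplane sequence $\mathcal{S}_{\boldsymbol{\alpha}}$ associated with $\boldsymbol{\alpha}$.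
   Context: $\mathbb{F}_q$ is the finite field with $q$ elements. For $m\in\mathbb{N}$, $R_m=\mathbb{F}_q[x]/(x^m)$ (elements identified with polynomials of degree $<m$). For each $i=1,\ldots,s$ and $m\in\mathbb{N}$ an ordered basis $\mathfrak{B}_{m,i}=\{\mathfrak{b}_{m,i,1},\ldots,\mathfrak{b}_{m,i,m}\}$ of $R_m$ over $\mathbb{F}_q$ is fixed such that for $1\le j\le m$ the coefficient vector of $\mathfrak{b}_{m+1,i,j}$ w.r.t. $\{1,\ldots,x^m\}$ equals that of $\mathfrak{b}_{m,i,j}$ w.r.t. $\{1,\ldots,x^{m-1}\}$ with a $0$ appended. $\theta_m:R_m^s\to\mathbb{F}_q^{sm}$ sends $(k_1,\ldots,k_s)$ to the concatenation of the coordinate vectors of $k_i$ w.r.t. $\mathfrak{B}_{m,i}$. $Y=\{\alpha\in\mathbb{F}_q[[x]]:\gcd(\alpha\bmod x^m,x^m)=1\ \forall m\}$; for $\boldsymbol{\alpha}\in Y^s$, $\boldsymbol{\alpha}^{(m)}$ is the coordinatewise reduction mod $x^m$. $\mathcal{N}'_{\boldsymbol{\alpha}^{(m)}}=\{\mathbf{k}\in R_m^s:\sum_i\alpha^{(m)}_ik_i\equiv0\pmod{x^m}\}$, $\mathcal{N}_{\boldsymbol{\alpha}^{(m)}}=\theta_m(\mathcal{N}'_{\boldsymbol{\alpha}^{(m)}})$. For matrices $C_1,\ldots,C_s\in\mathbb{F}_q^{\mathbb{N}\times\mathbb{N}}$ let $C_i^{(m)}$ be the upper-left $m\times m$ submatrix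 of $C_i$ and $C^{(m)}=(C_1^{(m)\top}\cdots C_s^{(m)\top})\in\mathbb{F}_q^{m\times sm}$. The matrices $C_1,\ldots,C_s$ are generating matrices of a hyperplane sequence associated with $\boldsymbol{\alpha}$ if, for every $m\in\mathbb{N}$, the row space of $C^{(m)}$ equals the orthogonal complement of $\mathcal{N}_{\boldsymbol{\alpha}^{(m)}}$ in $\mathbb{F}_q^{sm}$ w.r.t. the standard inner product (the digital sequence they generate is then the hyperplane sequence). *)

theory Defs
  imports
    "Jordan_Normal_Form.VS_Connect"
    "HOL-Computational_Algebra.Polynomial_FPS"
    "HOL-Number_Theory.Cong"
    "HOL-Library.Groups_Big_Fun"
    "HOL-Library.FuncSet"
begin

text \<open>
  The finite field with \<open>q\<close> elements is a type \<open>'a :: {field, finite}\<close>, with \<open>q = CARD('a)\<close>.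
  The indices \<open>i = 1, \<dots>, s\<close> of the components, \<open>j = 1, \<dots>, m\<close> of the basis elements, and the row
  and column indices of all matrices are shifted to start at \<open>0\<close>; the parameter \<open>m \<ge> 1\<close> is not
  shifted.
\<close>

global_interpretation poly_vs: vector_space "smult :: 'a::field \<Rightarrow> 'a poly \<Rightarrow> 'a poly"
  by standard (simp_all add: smult_add_right smult_add_left)

text \<open>The carrier of \<open>\<bbbF>\<^sub>q[x]/(x\<^sup>m)\<close>, each class being identified with its representative of
  degree less than \<open>m\<close> (for \<open>m \<ge> 1\<close>; the degree of \<open>0\<close> is \<open>0\<close>).\<close>

definition R :: "nat \<Rightarrow> 'a::field poly set" where
  "R m = {p. degree p < m}"

definition ordered_basis :: "nat \<Rightarrow> (nat \<Rightarrow> 'a::field poly) \<Rightarrow> bool" where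
  "ordered_basis m f \<longleftrightarrow>
     inj_on f {..<m} \<and> poly_vs.independent (f ` {..<m}) \<and> poly_vs.span (f ` {..<m}) = R m"

definition coeff_vec :: "nat \<Rightarrow> 'a::zero poly \<Rightarrow> 'a vec" where
  "coeff_vec m p = vec m (coeff p)"

text \<open>\<open>b m i j\<close> is the \<open>j\<close>-th element of the basis of \<^term>\<open>R m\<close> belonging to the component \<open>i\<close>.\<close>

definition basis_system :: "nat \<Rightarrow> (nat \<Rightarrow> nat \<Rightarrow> nat \<Rightarrow> 'a::field poly) \<Rightarrow> bool" where
  "basis_system s b \<longleftrightarrow>
     (\<forall>m\<ge>1. \<forall>i<s. ordered_basis m (b m i)) \<and>
     (\<forall>m\<ge>1. \<forall>i<s. \<forall>j<m.
        coeff_vec (m + 1) (b (m + 1) i j) = coeff_vec m (b m i j) @\<^sub>v vec_of_list [0])"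

definition coord :: "nat \<Rightarrow> (nat \<Rightarrow> 'a::field poly) \<Rightarrow> 'a poly \<Rightarrow> 'a vec" where
  "coord m f p = vec m (\<lambda>j. poly_vs.representation (f ` {..<m}) p (f j))"

text \<open>Position \<open>n\<close> of a concatenation of \<open>s\<close> blocks of length \<open>m\<close> is position \<open>n mod m\<close> of the
  block \<open>n div m\<close>.\<close>

definition theta ::
  "nat \<Rightarrow> (nat \<Rightarrow> nat \<Rightarrow> nat \<Rightarrow> 'a::field poly) \<Rightarrow> nat \<Rightarrow> (nat \<Rightarrow> 'a poly) \<Rightarrow> 'a vec" where
  "theta s b m k = vec (s * m) (\<lambda>n. coord m (b m (n div m)) (k (n div m)) $ (n mod m))"

text \<open>\<^term>\<open>truncate_fps m \<alpha>\<close> is \<open>\<alpha> mod x\<^sup>m\<close>. Coprimality is used instead of \<open>gcd = 1\<close> because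
  the library's \<open>gcd\<close> on polynomials needs more than the class \<open>field\<close> on the coefficients.\<close>

definition Y :: "'a::field fps set" where
  "Y = {\<alpha>. \<forall>m\<ge>1. coprime (truncate_fps m \<alpha>) (monom 1 m)}"

definition N' :: "nat \<Rightarrow> (nat \<Rightarrow> 'a::field fps) \<Rightarrow> nat \<Rightarrow> (nat \<Rightarrow> 'a poly) set" where
  "N' s \<alpha> m =
     {k \<in> {..<s} \<rightarrow>\<^sub>E R m. [(\<Sum>i<s. truncate_fps m (\<alpha> i) * k i) = 0] (mod (monom 1 m))}"

definition N ::
  "nat \<Rightarrow> (nat \<Rightarrow> nat \<Rightarrow> nat \<Rightarrow> 'a::field poly) \<Rightarrow> (nat \<Rightarrow> 'a fps) \<Rightarrow> nat \<Rightarrow> 'a vec set" where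
  "N s b \<alpha> m = theta s b m ` N' s \<alpha> m"

type_synonym 'a infmat = "nat \<Rightarrow> nat \<Rightarrow> 'a"

definition upper_left :: "nat \<Rightarrow> 'a infmat \<Rightarrow> 'a mat" where
  "upper_left m A = mat m m (\<lambda>(r, c). A r c)"

definition inf_transpose :: "'a infmat \<Rightarrow> 'a infmat" where
  "inf_transpose A = (\<lambda>r c. A c r)"

text \<open>The sum below is the sum of the nonzero terms. It is meaningful only if these are finitely
  many, e.g. if every row of \<open>A\<close> or every column of \<open>B\<close> has finite support.\<close>

definition inf_mult :: "'a::semiring_0 infmat \<Rightarrow> 'a infmat \<Rightarrow> 'a infmat" where
  "inf_mult A B = (\<lambda>r c. Sum_any (\<lambda>k. A r k * B k c))"

definition overall_mat :: "nat \<Rightarrow> (nat \<Rightarrow> 'a infmat) \<Rightarrow> nat \<Rightarrow> 'a mat" where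
  "overall_mat s C m =
     mat m (s * m) (\<lambda>(r, n). transpose_mat (upper_left m (C (n div m))) $$ (r, n mod m))"

definition hyperplane_generating_matrices ::
  "nat \<Rightarrow> (nat \<Rightarrow> nat \<Rightarrow> nat \<Rightarrow> 'a::field poly) \<Rightarrow> (nat \<Rightarrow> 'a fps) \<Rightarrow> (nat \<Rightarrow> 'a infmat) \<Rightarrow> bool"
  where
  "hyperplane_generating_matrices s b \<alpha> C \<longleftrightarrow>
     (\<forall>m\<ge>1. vec_space.row_space (s * m) (overall_mat s C m) =
            vec_module.orthogonal_complement (s * m) (N s b \<alpha> m))"

text \<open>Column \<open>c\<close> here is the column with number \<open>j = c + 1\<close> when counting from \<open>1\<close>, so it is given
  by the last element of the basis of \<^term>\<open>R (c + 1)\<close>.\<close>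

definition basis_mat :: "(nat \<Rightarrow> nat \<Rightarrow> nat \<Rightarrow> 'a::zero poly) \<Rightarrow> nat \<Rightarrow> 'a infmat" where
  "basis_mat b i = (\<lambda>r c. if r < c + 1 then coeff (b (c + 1) i c) r else 0)"

definition Psi :: "'a::zero fps \<Rightarrow> 'a infmat" where
  "Psi \<alpha> = (\<lambda>r c. if r \<ge> c then fps_nth \<alpha> (r - c) else 0)"

end

theory Submission
  imports Defs "Jordan_Normal_Form.Matrix_Kernel"
begin

text \<open>
  Write \<open>M\<close> for the \<open>m \<times> sm\<close> matrix \<open>C\<^bsup>(m)\<^esup>\<close>. Its entry in row \<open>r\<close> at position \<open>j\<close> of block \<open>i\<close> is the
  coefficient of \<open>x\<^sup>r\<close> in \<open>\<alpha>\<^sub>i \<bb>\<^bsub>m,i,j\<^esub>\<close>, so \<open>M\<close> maps \<open>\<theta>\<^sub>m(k)\<close> to the first \<open>m\<close> coefficients of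
  \<open>\<Sum>\<^sub>i \<alpha>\<^sub>i k\<^sub>i\<close>; as \<open>\<theta>\<^sub>m\<close> is onto, the kernel of \<open>M\<close> is \<open>\<N>\<close>. Since \<open>\<alpha>\<^sub>0\<close> is a unit, \<open>M\<close> has a
  right inverse \<open>X\<close>. Every \<open>v - X M v\<close> lies in the kernel, so a vector \<open>w\<close> orthogonal to the kernel
  satisfies \<open>w = M\<^sup>T (X\<^sup>T w)\<close> and lies in the row space.
\<close>

section \<open>Row space and kernel of a matrix with a right inverse\<close>

lemma row_space_eq_orthogonal_complement_mat_kernel:
  fixes M :: "'a::field mat"
  assumes M: "M \<in> carrier_mat m n" and X: "X \<in> carrier_mat n m" and MX: "M * X = 1\<^sub>m m"
  shows "vec_space.row_space n M = vec_module.orthogonal_complement n (mat_kernel M)"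
proof -
  interpret vec_space "TYPE('a)" n .
  have Mt: "M\<^sup>T \<in> carrier_mat n m" and Xt: "X\<^sup>T \<in> carrier_mat m n"
    using M X by auto
  note adj = transpose_vec_mult_scalar[OF M] and adjX = transpose_vec_mult_scalar[OF X]
  show ?thesis
  proof (intro equalityI subsetI)
    fix w assume "w \<in> row_space M"
    then obtain y where y: "y \<in> carrier_vec m" and w: "w = M\<^sup>T *\<^sub>v y"
      using row_space_eq[OF M] M by auto
    show "w \<in> orthogonal_complement (mat_kernel M)"
      unfolding orthogonal_complement_def w
      using Mt y mat_kernelD[OF M] by (auto simp: adj)
  next
    fix w assume "w \<in> orthogonal_complement (mat_kernel M)"
    then have w: "w \<in> carrier_vec n" and orth: "\<And>v. v \<in> mat_kernel M \<Longrightarrow> w \<bullet> v = 0"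
      by (auto simp: orthogonal_complement_def)
    have y: "X\<^sup>T *\<^sub>v w \<in> carrier_vec m"
      using Xt w by auto
    have "(M\<^sup>T *\<^sub>v (X\<^sup>T *\<^sub>v w)) \<bullet> v = w \<bullet> v" if v: "v \<in> carrier_vec n" for v
    proof -
      have Mv: "M *\<^sub>v v \<in> carrier_vec m" and XMv: "X *\<^sub>v (M *\<^sub>v v) \<in> carrier_vec n"
        using M X v by auto
      \<comment> \<open>\<open>X * M\<close> acts as a projection that \<open>M\<close> does not
        notice, so \<open>v\<close> splits into a kernel vector, on which \<open>w\<close> vanishes,
        and \<open>X M v\<close>.\<close>
      have "M *\<^sub>v (X *\<^sub>v (M *\<^sub>v v)) = M *\<^sub>v v"
        using assoc_mult_mat_vec[OF M X Mv] Mv by (simp add: MX)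
      then have "M *\<^sub>v (v - X *\<^sub>v (M *\<^sub>v v)) = 0\<^sub>v m"
        using mult_minus_distrib_mat_vec[OF M v XMv] Mv by simp
      then have "w \<bullet> (v - X *\<^sub>v (M *\<^sub>v v)) = 0"
        using v XMv by (intro orth mat_kernelI[OF M]) auto
      then have "w \<bullet> v = w \<bullet> (X *\<^sub>v (M *\<^sub>v v))"
        using scalar_prod_minus_distrib[OF w v XMv] by simp
      then show ?thesis
        using adj[OF v y] adjX[OF Mv w] by simp
    qed
    \<comment> \<open>Pairing with unit vectors reads off the entries of both sides.\<close>
    then have "(M\<^sup>T *\<^sub>v (X\<^sup>T *\<^sub>v w)) \<bullet> unit_vec n i = w \<bullet> unit_vec n i" for i
      by simp
    then have "M\<^sup>T *\<^sub>v (X\<^sup>T *\<^sub>v w) = w"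
      using w Mt y by (intro eq_vecI)
        (auto simp del: index_mult_mat_vec, metis scalar_prod_right_unit mult_mat_vec_carrier)
    then show "w \<in> row_space M"
      using row_space_eq[OF M] M w y by auto
  qed
qed

section \<open>Blocks, coordinates and surjectivity of \<open>theta\<close>\<close>

lemma sum_div_mod:
  fixes g :: "nat \<Rightarrow> nat \<Rightarrow> 'b::comm_monoid_add"
  shows "(\<Sum>n<s * m. g (n div m) (n mod m)) = (\<Sum>i<s. \<Sum>j<m. g i j)"
proof -
  \<comment> \<open>On block \<open>i\<close> the quotient is constantly \<open>i\<close> and the
    remainder is the offset \<open>n - i * m\<close>.\<close>
  have "(\<Sum>n=i * m..<i * m + m. g (n div m) (n mod m)) = (\<Sum>j<m. g i j)" for i
    by (rule sum.reindex_bij_witness[where i = "\<lambda>j. i * m + j" and j = "\<lambda>n. n - i * m"])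
      (auto simp: div_nat_eqI mod_nat_eqI le_iff_add)
  then show ?thesis
    by (simp flip: sum.nat_group)
qed

lemma ordered_basis_in_R:
  assumes "ordered_basis m f" "j < m"
  shows "f j \<in> R m"
  using assms poly_vs.span_base[of "f j" "f ` {..<m}"] by (auto simp: ordered_basis_def)

lemma sum_coord:
  assumes "ordered_basis m f" "p \<in> R m"
  shows "(\<Sum>j<m. smult (coord m f p $ j) (f j)) = p"
proof -
  let ?B = "f ` {..<m}"
  have *: "inj_on f {..<m}" "poly_vs.independent ?B" "p \<in> poly_vs.span ?B"
    using assms by (auto simp: ordered_basis_def)
  \<comment> \<open>\<open>representation\<close> is indexed by basis elements, \<open>coord\<close>
    by their positions; injectivity of \<open>f\<close> makes the two sums agree.\<close>
  have "(\<Sum>j<m. smult (coord m f p $ j) (f j)) = (\<Sum>c\<in>?B. smult (poly_vs.representation ?B p c) c)"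
    by (simp add: sum.reindex[OF *(1)] coord_def)
  also have "\<dots> = p"
    using * by (intro poly_vs.sum_representation_eq) auto
  finally show ?thesis .
qed

lemma coord_sum:
  assumes f: "ordered_basis m f" and v: "v \<in> carrier_vec m"
  shows "coord m f (\<Sum>j<m. smult (v $ j) (f j)) = v"
proof (rule eq_vecI)
  let ?B = "f ` {..<m}"
  have *: "inj_on f {..<m}" "poly_vs.independent ?B"
    using f by (auto simp: ordered_basis_def)
  fix l assume "l < dim_vec v"
  then have l: "l < m"
    using v by simp
  have "poly_vs.representation ?B (\<Sum>j<m. smult (v $ j) (f j)) (f l)
      = (\<Sum>j<m. poly_vs.representation ?B (smult (v $ j) (f j)) (f l))"
    using * by (subst poly_vs.representation_sum)
      (auto intro: poly_vs.span_scale poly_vs.span_base)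
  \<comment> \<open>A basis element represents itself, and \<open>f j = f l\<close> forces
    \<open>j = l\<close>.\<close>
  also have "\<dots> = (\<Sum>j<m. if j = l then v $ j else 0)"
    using * l by (intro sum.cong)
      (auto simp: poly_vs.representation_scale poly_vs.span_base poly_vs.representation_basis
        dest: inj_onD)
  finally show "coord m f (\<Sum>j<m. smult (v $ j) (f j)) $ l = v $ l"
    using l by (simp add: coord_def)
qed (use v in \<open>simp add: coord_def\<close>)

lemma sum_smult_in_R:
  assumes "ordered_basis m f"
  shows "(\<Sum>j<m. smult (c j) (f j)) \<in> R m"
proof -
  have "(\<Sum>j<m. smult (c j) (f j)) \<in> poly_vs.span (f ` {..<m})"
    by (intro poly_vs.span_sum poly_vs.span_scale poly_vs.span_base) auto
  then show ?thesis
    using assms by (simp add: ordered_basis_def)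
qed

text \<open>Cut \<open>v\<close> into \<open>s\<close> blocks of length \<open>m\<close> and use
  block \<open>i\<close> as the coordinates of the component \<open>k i\<close>.\<close>

lemma theta_surj:
  assumes basis: "\<And>i. i < s \<Longrightarrow> ordered_basis m (b m i)" and v: "v \<in> carrier_vec (s * m)"
  obtains k where "k \<in> {..<s} \<rightarrow>\<^sub>E R m" "theta s b m k = v"
proof
  define w where "w i = vec m (\<lambda>j. v $ (i * m + j))" for i
  define k where "k = restrict (\<lambda>i. \<Sum>j<m. smult (w i $ j) (b m i j)) {..<s}"
  show "k \<in> {..<s} \<rightarrow>\<^sub>E R m"
    using basis by (auto simp: k_def intro: sum_smult_in_R)
  show "theta s b m k = v"
  proof (rule eq_vecI)
    fix n assume "n < dim_vec v"
    then have n: "n < s * m"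
      using v by simp
    then have m: "m > 0"
      by (cases m) auto
    have d: "n div m < s"
      using n by (simp add: less_mult_imp_div_less)
    then have "coord m (b m (n div m)) (k (n div m)) = w (n div m)"
      using basis coord_sum[of m _ "w (n div m)"] by (simp add: k_def, simp add: w_def)
    then show "theta s b m k $ n = v $ n"
      using n m by (simp add: theta_def w_def)
  qed (use v in \<open>simp add: theta_def\<close>)
qed

section \<open>Compatible bases and the entries of the generating matrices\<close>

lemma basis_system_Suc:
  assumes b: "basis_system s b" and i: "i < s" and j: "j < m"
  shows "b (Suc m) i j = b m i j"
proof (rule poly_eqI)
  fix k
  have m: "m \<ge> 1"
    using j by simp
  have "ordered_basis m (b m i)" "ordered_basis (Suc m) (b (Suc m) i)"
    using b i m by (auto simp: basis_system_def)
  then have R: "b m i j \<in> R m" "b (Suc m) i j \<in> R (Suc m)"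
    using j by (auto intro: ordered_basis_in_R)
  have app: "coeff_vec (Suc m) (b (Suc m) i j) = coeff_vec m (b m i j) @\<^sub>v vec_of_list [0]"
    using b i j m by (auto simp: basis_system_def)
  show "coeff (b (Suc m) i j) k = coeff (b m i j) k"
  \<comment> \<open>Both polynomials have degree at most \<open>m\<close>, so the compared vectors
    of length \<open>Suc m\<close> determine them.\<close>
  proof (cases "k < Suc m")
    case True
    then have "coeff (b (Suc m) i j) k = (coeff_vec m (b m i j) @\<^sub>v vec_of_list [0]) $ k"
      unfolding app[symmetric] by (simp add: coeff_vec_def)
    also have "\<dots> = coeff (b m i j) k"
    \<comment> \<open>Position \<open>m\<close> holds the appended \<open>0\<close>, which is also
      the coefficient of \<open>b m i j\<close> there, its degree being below
      \<open>m\<close>.\<close>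
    proof (cases "k = m")
      case True
      then show ?thesis
        using R by (simp add: coeff_vec_def R_def coeff_eq_0)
    qed (use True in \<open>simp add: coeff_vec_def\<close>)
    finally show ?thesis .
  next
    case False
    then show ?thesis
      using R by (simp add: R_def coeff_eq_0)
  qed
qed

text \<open>Level \<open>Suc j\<close> is the first one with an element of index \<open>j\<close>;
  climbing from there to \<open>m\<close> never changes it. Hence the columns of
  \<open>basis_mat\<close>, taken from different levels, form the basis of any one level
  \<open>m\<close>.\<close>

lemma basis_system_eq:
  assumes "basis_system s b" "i < s" "j < m"
  shows "b m i j = b (Suc j) i j"
proof -
  have "Suc j \<le> m"
    using assms by simp
  then show ?thesis
    by (induction rule: dec_induct) (use assms in \<open>auto simp: basis_system_Suc\<close>)
qed

text \<open>Below the diagonal the cutoff in \<open>basis_mat\<close> agrees with the coefficient,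
  because the element has degree at most \<open>c\<close>.\<close>

lemma basis_mat_eq_coeff:
  assumes "basis_system s b" "i < s" "c < m"
  shows "basis_mat b i r c = coeff (b m i c) r"
proof -
  have "ordered_basis (Suc c) (b (Suc c) i)"
    using assms by (auto simp: basis_system_def)
  then have "b (Suc c) i c \<in> R (Suc c)"
    by (auto intro: ordered_basis_in_R)
  then show ?thesis
    using basis_system_eq[OF assms] by (simp add: basis_mat_def R_def coeff_eq_0)
qed

text \<open>\<open>Psi \<alpha>\<close> is multiplication by \<open>\<alpha>\<close> in the monomial
  basis. Row \<open>r\<close> of it is supported on \<open>k \<le> r\<close>, which makes the
  infinite sum the finite Cauchy product.\<close>

lemma inf_mult_Psi_basis_mat:
  assumes "basis_system s b" "i < s" "c < m"
  shows "inf_mult (Psi \<alpha>) (basis_mat b i) r c = fps_nth (\<alpha> * fps_of_poly (b m i c)) r"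
proof -
  have "inf_mult (Psi \<alpha>) (basis_mat b i) r c = (\<Sum>k\<le>r. Psi \<alpha> r k * basis_mat b i k c)"
    unfolding inf_mult_def by (rule Sum_any.expand_superset) (auto simp: Psi_def)
  also have "\<dots> = (\<Sum>k\<le>r. fps_nth \<alpha> (r - k) * coeff (b m i c) k)"
    by (intro sum.cong) (auto simp: Psi_def basis_mat_eq_coeff[OF assms])
  also have "\<dots> = fps_nth (fps_of_poly (b m i c) * \<alpha>) r"
    unfolding fps_mult_nth by (simp add: atLeast0AtMost mult.commute)
  finally show ?thesis
    by (simp add: mult.commute)
qed

section \<open>The kernel of the overall matrix\<close>

lemma fps_nth_mult_sum_coord:
  assumes "ordered_basis m f" "p \<in> R m"
  shows "fps_nth (\<alpha> * fps_of_poly p) r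
    = (\<Sum>j<m. fps_nth (\<alpha> * fps_of_poly (f j)) r * coord m f p $ j)"
proof -
  have "\<alpha> * fps_of_poly p = (\<Sum>j<m. fps_const (coord m f p $ j) * (\<alpha> * fps_of_poly (f j)))"
    by (subst sum_coord[OF assms, symmetric])
      (simp add: fps_of_poly_sum fps_of_poly_smult sum_distrib_left mult.left_commute)
  then show ?thesis
    by (simp add: fps_sum_nth mult.commute)
qed

lemma overall_mat_mult_theta:
  fixes b :: "nat \<Rightarrow> nat \<Rightarrow> nat \<Rightarrow> 'a::field poly"
  assumes b: "basis_system s b" and m: "m \<ge> 1" and k: "\<And>i. i < s \<Longrightarrow> k i \<in> R m"
  shows "overall_mat s (\<lambda>i. inf_transpose (inf_mult (Psi (\<alpha> i)) (basis_mat b i))) m *\<^sub>v theta s b m k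
    = vec m (fps_nth (\<Sum>i<s. \<alpha> i * fps_of_poly (k i)))" (is "?M *\<^sub>v _ = _")
proof (rule eq_vecI)
  fix r assume "r < dim_vec (vec m (fps_nth (\<Sum>i<s. \<alpha> i * fps_of_poly (k i))))"
  then have r: "r < m"
    by simp
  let ?g = "\<lambda>i j. fps_nth (\<alpha> i * fps_of_poly (b m i j)) r * coord m (b m i) (k i) $ j"
  have "(?M *\<^sub>v theta s b m k) $ r = (\<Sum>n<s * m. ?M $$ (r, n) * theta s b m k $ n)"
    using r by (simp add: overall_mat_def theta_def scalar_prod_def atLeast0LessThan)
  also have "\<dots> = (\<Sum>n<s * m. ?g (n div m) (n mod m))"
  proof (intro sum.cong refl)
    fix n assume "n \<in> {..<s * m}"
    then have "n < s * m" "n div m < s" "n mod m < m"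
      using m by (auto simp: less_mult_imp_div_less)
    \<comment> \<open>The transpose in \<open>overall_mat\<close> cancels
      \<open>inf_transpose\<close>, leaving the entry of the product in row \<open>r\<close> and
      column \<open>n mod m\<close>.\<close>
    then show "?M $$ (r, n) * theta s b m k $ n = ?g (n div m) (n mod m)"
      using r by (simp add: overall_mat_def theta_def upper_left_def inf_transpose_def
          inf_mult_Psi_basis_mat[OF b])
  qed
  also have "\<dots> = (\<Sum>i<s. \<Sum>j<m. ?g i j)"
    by (rule sum_div_mod)
  also have "\<dots> = (\<Sum>i<s. fps_nth (\<alpha> i * fps_of_poly (k i)) r)"
    using b m k by (intro sum.cong refl fps_nth_mult_sum_coord[symmetric])
      (auto simp: basis_system_def)
  finally show "(?M *\<^sub>v theta s b m k) $ r = vec m (fps_nth (\<Sum>i<s. \<alpha> i * fps_of_poly (k i))) $ r"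
    using r by (simp add: fps_sum_nth)
qed (simp add: overall_mat_def)

text \<open>Divisibility by \<open>monom 1 m\<close> is the vanishing of the coefficients below
  \<open>m\<close>, and these see only the coefficients of \<open>\<alpha> i\<close> below
  \<open>m\<close>, so truncation does not affect them.\<close>

lemma cong_0_monom_iff:
  "[(\<Sum>i<s. truncate_fps m (\<alpha> i) * k i) = 0] (mod (monom 1 m)) \<longleftrightarrow>
   (\<forall>r<m. fps_nth (\<Sum>i<s. \<alpha> i * fps_of_poly (k i)) r = 0)"
  for \<alpha> :: "nat \<Rightarrow> 'a::field fps"
proof -
  have "coeff (\<Sum>i<s. truncate_fps m (\<alpha> i) * k i) r = fps_nth (\<Sum>i<s. \<alpha> i * fps_of_poly (k i)) r"
    if "r < m" for r
    using that by (simp add: coeff_sum fps_sum_nth coeff_mult fps_mult_nth atLeast0AtMost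
        coeff_truncate_fps)
  then show ?thesis
    by (simp add: cong_0_iff monom_1_dvd_iff')
qed

lemma N_eq_mat_kernel:
  assumes b: "basis_system s b" and m: "m \<ge> 1"
  shows "N s b \<alpha> m
    = mat_kernel (overall_mat s (\<lambda>i. inf_transpose (inf_mult (Psi (\<alpha> i)) (basis_mat b i))) m)"
    (is "_ = mat_kernel ?M")
proof -
  have M: "?M \<in> carrier_mat m (s * m)"
    by (simp add: overall_mat_def)
  have iff: "theta s b m k \<in> mat_kernel ?M \<longleftrightarrow> k \<in> N' s \<alpha> m" if "k \<in> {..<s} \<rightarrow>\<^sub>E R m" for k
  proof -
    have "k i \<in> R m" if "i < s" for i
      using that \<open>k \<in> _\<close> by auto
    note * = overall_mat_mult_theta[OF b m this, where \<alpha> = \<alpha>]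
    have "theta s b m k \<in> carrier_vec (s * m)"
      by (simp add: theta_def)
    then have "theta s b m k \<in> mat_kernel ?M \<longleftrightarrow> ?M *\<^sub>v theta s b m k = 0\<^sub>v m"
      using mat_kernel[OF M] by auto
    also have "\<dots> \<longleftrightarrow> (\<forall>r<m. fps_nth (\<Sum>i<s. \<alpha> i * fps_of_poly (k i)) r = 0)"
      by (simp add: * vec_eq_iff)
    also have "\<dots> \<longleftrightarrow> k \<in> N' s \<alpha> m"
      using that by (simp add: N'_def cong_0_monom_iff)
    finally show ?thesis .
  qed
  show ?thesis
  proof (intro equalityI subsetI)
    fix v assume "v \<in> N s b \<alpha> m"
    then show "v \<in> mat_kernel ?M"
      using iff by (auto simp: N_def N'_def)
  next
    fix v assume v: "v \<in> mat_kernel ?M"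
    \<comment> \<open>The equivalence \<open>iff\<close> speaks only of vectors in the image of
      \<open>theta\<close>, so a kernel vector is first written in that form.\<close>
    have "\<And>i. i < s \<Longrightarrow> ordered_basis m (b m i)"
      using b m by (auto simp: basis_system_def)
    then obtain k where "k \<in> {..<s} \<rightarrow>\<^sub>E R m" "theta s b m k = v"
      using mat_kernelD(1)[OF M v] by (rule theta_surj)
    then show "v \<in> N s b \<alpha> m"
      using v iff by (auto simp: N_def)
  qed
qed

section \<open>A right inverse from the unit \<open>\<alpha> 0\<close>\<close>

lemma Y_nth_0:
  assumes "\<alpha> \<in> Y"
  shows "fps_nth \<alpha> 0 \<noteq> 0"
proof
  assume "fps_nth \<alpha> 0 = 0"
  \<comment> \<open>The instance \<open>m = 1\<close> of \<open>Y\<close> decides: \<open>0\<close>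
    is coprime only to units, and \<open>x\<close> is not one.\<close>
  then have "truncate_fps 1 \<alpha> = 0"
    by (intro poly_eqI) (simp add: coeff_truncate_fps)
  then have "is_unit (monom 1 1 :: 'a poly)"
    using assms by (auto simp: Y_def dest!: spec[of _ 1])
  then show False
    by (simp add: is_unit_iff_degree degree_monom_eq)
qed

text \<open>Column \<open>r\<close> of \<open>X\<close> encodes the tuple whose only nonzero
  component is \<open>x^r\<close> divided by \<open>\<alpha> 0\<close>, modulo \<open>x^m\<close>.
  The matrix sends it to the first \<open>m\<close> coefficients of \<open>x^r\<close>, the unit
  vector number \<open>r\<close>.\<close>

lemma overall_mat_right_inverse:
  fixes b :: "nat \<Rightarrow> nat \<Rightarrow> nat \<Rightarrow> 'a::field poly"
  assumes s: "s > 0" and b: "basis_system s b" and m: "m \<ge> 1" and \<alpha>: "\<alpha> 0 \<in> Y"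
  obtains X where "X \<in> carrier_mat (s * m) m"
    "overall_mat s (\<lambda>i. inf_transpose (inf_mult (Psi (\<alpha> i)) (basis_mat b i))) m * X = 1\<^sub>m m"
proof
  let ?M = "overall_mat s (\<lambda>i. inf_transpose (inf_mult (Psi (\<alpha> i)) (basis_mat b i))) m"
  define p where "p r = truncate_fps m (inverse (\<alpha> 0) * fps_X ^ r)" for r
  define k where "k r = (\<lambda>i::nat. if i = 0 then p r else 0)" for r
  define X where "X = mat_of_cols (s * m) (map (\<lambda>r. theta s b m (k r)) [0..<m])"
  show X: "X \<in> carrier_mat (s * m) m"
    by (simp add: X_def mat_of_cols_def)
  have M: "?M \<in> carrier_mat m (s * m)"
    by (simp add: overall_mat_def)
  have prod: "fps_nth (\<alpha> 0 * fps_of_poly (p r)) l = (if l = r then 1 else 0)" if "l < m" for l r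
  proof -
    \<comment> \<open>Since \<open>l < m\<close>, only coefficients untouched by the truncation in
      \<open>p r\<close> contribute.\<close>
    have "fps_nth (\<alpha> 0 * fps_of_poly (p r)) l = fps_nth (\<alpha> 0 * (inverse (\<alpha> 0) * fps_X ^ r)) l"
      unfolding fps_mult_nth[of "\<alpha> 0"] using that
      by (intro sum.cong) (auto simp: p_def coeff_truncate_fps)
    also have "\<alpha> 0 * (inverse (\<alpha> 0) * fps_X ^ r) = fps_X ^ r"
      using inverse_mult_eq_1'[OF Y_nth_0[OF \<alpha>]] by (simp flip: mult.assoc)
    finally show ?thesis
      by simp
  qed
  \<comment> \<open>The zero components lie in \<open>R m\<close> because \<open>m \<ge> 1\<close>
    and \<open>0\<close> has degree \<open>0\<close>.\<close>
  have R: "k r i \<in> R m" for r i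
    using m by (auto simp: k_def p_def R_def degree_truncate_fps)
  have "(\<Sum>i<s. \<alpha> i * fps_of_poly (k r i)) = \<alpha> 0 * fps_of_poly (p r)" for r
  proof -
    have "(\<Sum>i<s. \<alpha> i * fps_of_poly (k r i)) = (\<Sum>i<s. if i = 0 then \<alpha> 0 * fps_of_poly (p r) else 0)"
      by (intro sum.cong) (auto simp: k_def)
    then show ?thesis
      using s by simp
  qed
  then have Mx: "?M *\<^sub>v theta s b m (k r) = vec m (fps_nth (\<alpha> 0 * fps_of_poly (p r)))" for r
    using overall_mat_mult_theta[OF b m R, where \<alpha> = \<alpha>] by simp
  show "?M * X = 1\<^sub>m m"
  proof (rule eq_matI)
    fix l r assume "l < dim_row (1\<^sub>m m :: 'a mat)" "r < dim_col (1\<^sub>m m :: 'a mat)"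
    then have lr: "l < m" "r < m"
      by auto
    have "col X r = theta s b m (k r)"
      using lr by (auto simp: X_def theta_def col_mat_of_cols)
    then have "(?M * X) $$ (l, r) = (?M *\<^sub>v theta s b m (k r)) $ l"
      using lr M X by simp
    then show "(?M * X) $$ (l, r) = 1\<^sub>m m $$ (l, r)"
      using lr by (simp add: Mx prod)
  qed (use M X in auto)
qed

section \<open>Combining kernel and right inverse at every level \<open>m\<close>\<close>

theorem theorem8:
  fixes s :: nat
    and b :: "nat \<Rightarrow> nat \<Rightarrow> nat \<Rightarrow> 'a::{field, finite} poly"
    and \<alpha> :: "nat \<Rightarrow> 'a fps"
  assumes "s \<ge> 2"
    and "basis_system s b"
    and "\<forall>i<s. \<alpha> i \<in> Y"
  shows "hyperplane_generating_matrices s b \<alpha>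
           (\<lambda>i. inf_transpose (inf_mult (Psi (\<alpha> i)) (basis_mat b i)))"
  unfolding hyperplane_generating_matrices_def
proof (intro allI impI)
  fix m :: nat assume m: "m \<ge> 1"
  let ?M = "overall_mat s (\<lambda>i. inf_transpose (inf_mult (Psi (\<alpha> i)) (basis_mat b i))) m"
  have s: "s > 0" and \<alpha>: "\<alpha> 0 \<in> Y"
    using assms by auto
  obtain X where X: "X \<in> carrier_mat (s * m) m" "?M * X = 1\<^sub>m m"
    using overall_mat_right_inverse[where \<alpha> = \<alpha>, OF s assms(2) m \<alpha>] .
  have "?M \<in> carrier_mat m (s * m)"
    by (simp add: overall_mat_def)
  from row_space_eq_orthogonal_complement_mat_kernel[OF this X]
  show "vec_space.row_space (s * m) ?M = vec_module.orthogonal_complement (s * m) (N s b \<alpha> m)"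
    by (simp add: N_eq_mat_kernel[OF assms(2) m])
qed

end
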